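(* Let $d,n\ge1$ and let $\mathbf{Q}=(Q_1,\dots,Q_n)$ be an $n$-tuple of real quadratic forms in $d$ variables. If $\mathfrak{d}_{d,1}(\mathbf{Q})=d$, then $$\mathfrak{d}_{d',n'}(\mathbf{Q})\ge\frac{n'}{n}d-2(d-d')$$ for all integers $d'$ with $\frac d2\le d'\le d$ and all integers $n'$ with $0\le n'\le n$.
   Context: For $M\in\mathbb{R}^{d\times d}$, $N\in\mathbb{R}^{n\times n'}$ let $R_{N,M}\mathbf{Q}=(\mathbf{Q}\circ M)\cdot N$ (an $n'$-tuple of quadratic forms in $d$ variables; $R_{N,M}\mathbf{Q}=(0)$ if $n'=0$). $\mathrm{NV}$ of a tuple of quadratic forms in $d$ variables is the number of indices $i\in\{1,\dots,d\}$ such that $\partial_{\xi_i}$ of some component is not identically zero. For $0\le d'\le d$ and $0\le n'\le n$, $$\mathfrak{d}_{d',n'}(\mathbf{Q})=\inf_{M\in\mathbb{R}^{d\times d},\,\mathrm{rank}(M)=d'}\ \inf_{N\in\mathbb{R}^{n\times n'},\,\mathrm{rank}(N)=n'}\mathrm{NV}(R_{N,M}\mathbf{Q}).$$ *)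

theory Defs
  imports "HOL-Analysis.Derivative" "Jordan_Normal_Form.DL_Rank"
begin

definition quadratic_form :: "nat \<Rightarrow> (real Matrix.vec \<Rightarrow> real) \<Rightarrow> bool" where
  "quadratic_form d Q \<longleftrightarrow>
     (\<exists>a :: nat \<Rightarrow> nat \<Rightarrow> real. \<forall>x \<in> carrier_vec d.
        Q x = (\<Sum>i<d. \<Sum>j<d. a i j * vec_index x i * vec_index x j))"

definition partial_deriv ::
    "nat \<Rightarrow> nat \<Rightarrow> (real Matrix.vec \<Rightarrow> real) \<Rightarrow> real Matrix.vec \<Rightarrow> real" where
  "partial_deriv d i F x = deriv (\<lambda>t. F (x + t \<cdot>\<^sub>v unit_vec d i)) 0"

text \<open>Tuples of forms are lists, and the variables are indexed by \<open>0, \<dots>, d - 1\<close>.\<close>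

definition NV :: "nat \<Rightarrow> (real Matrix.vec \<Rightarrow> real) list \<Rightarrow> nat" where
  "NV d Qs = card {i. i < d \<and>
     (\<exists>F \<in> set Qs. \<exists>x \<in> carrier_vec d. partial_deriv d i F x \<noteq> 0)}"

text \<open>The tuple \<open>(Q \<circ> M) \<cdot> N\<close> is a row of functions times a matrix. If \<open>N\<close> has no columns,
  it is by convention the one-element tuple consisting of the zero form.\<close>

definition R_transform ::
    "real Matrix.mat \<Rightarrow> real Matrix.mat \<Rightarrow> (real Matrix.vec \<Rightarrow> real) list \<Rightarrow> (real Matrix.vec \<Rightarrow> real) list"
  where
  "R_transform N M Qs =
     (if dim_col N = 0 then [\<lambda>x. 0]
      else map (\<lambda>k x. \<Sum>j<length Qs. (Qs ! j) (M *\<^sub>v x) * index_mat N (j, k)) [0..<dim_col N])"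

text \<open>Both infima are over nonempty sets of naturals when \<open>d' \<le> d\<close> and
  \<open>n' \<le> length Qs\<close>; outside this range the value is unspecified.\<close>

definition frak_d :: "nat \<Rightarrow> (real Matrix.vec \<Rightarrow> real) list \<Rightarrow> nat \<Rightarrow> nat \<Rightarrow> nat" where
  "frak_d d Qs d' n' =
     (INF M \<in> {M \<in> carrier_mat d d. vec_space.rank d M = d'}.
      INF N \<in> {N \<in> carrier_mat (length Qs) n'. vec_space.rank (length Qs) N = n'}.
        NV d (R_transform N M Qs))"

end

theory Submission
  imports Defs
begin

text \<open>
  The hypothesis says that no nontrivial linear combination \<open>F\<close> of the forms loses a variable under
  an invertible change of coordinates. This forces the Hessian \<open>S\<close> of \<open>F\<close> to be nonsingular, since
  otherwise a kernel vector of \<open>S\<close> could be made a coordinate direction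
  (\<open>hessian_nonsingular\<close>).

  For \<open>n' = 0\<close> the asserted bound is not positive. For \<open>n' \<ge> 1\<close> the matrix \<open>N\<close> has a nonzero column,
  so the transformed tuple contains \<open>F \<circ> M\<close> for some nontrivial combination \<open>F\<close>, and it suffices to
  bound the number of variables of this single form. A substitution \<open>M\<close> of rank \<open>d'\<close> lowers the rank
  of the Hessian by at most \<open>2 (d - d')\<close>, so \<open>F \<circ> M\<close> depends on at least \<open>d - 2 (d - d')\<close> variables
  (\<open>NV_pullback_ge\<close>). Since \<open>n' / n \<le> 1\<close>, this is at least the asserted bound.

  The rank loss is estimated without passing to the row rank of \<open>M\<close>: the matrix \<open>M\<close> is compared
  with an invertible \<open>P\<close> sharing \<open>d'\<close> of its columns (\<open>invertible_sharing_columns\<close>). If \<open>F \<circ> M\<close> does not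
  depend on the variable of a shared column, then the nonsingular matrix \<open>P\<^sup>T S P\<close> has zeros in that
  row at all shared positions, and the size of a zero block in a nonsingular matrix is limited
  (\<open>det_zero_block\<close>).
\<close>

section \<open>Invertible matrices with prescribed columns\<close>

text \<open>A set that is maximal among the independent sets containing \<open>U\<close> is also maximal among all
  independent sets, hence a basis.\<close>

lemma (in vec_space) basis_extension:
  assumes "U \<subseteq> carrier_vec n" "lin_indpt U"
  shows "\<exists>W. U \<subseteq> W \<and> W \<subseteq> carrier_vec n \<and> lin_indpt W \<and> finite W \<and> card W = n"
proof -
  let ?P = "\<lambda>T. U \<subseteq> T \<and> T \<subseteq> carrier_vec n \<and> lin_indpt T"
  have bound: "finite T \<and> card T \<le> n" if "?P T" for T
    using li_le_dim[of T] that dim_is_n by auto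
  obtain W where W: "finite W" "maximal W ?P"
  proof -
    have "\<exists>W. finite W \<and> maximal W ?P"
      by (rule maximal_exists[where N = n and B = U]) (use bound assms in blast)+
    then show thesis using that by blast
  qed
  have "maximal W (\<lambda>T. T \<subseteq> carrier_vec n \<and> lin_indpt T)"
    using W(2) unfolding maximal_def by (metis order_trans)
  then have "basis W" by (rule max_li_is_basis)
  then have "card W = n" using dim_basis[OF W(1)] dim_is_n by simp
  then show ?thesis using W unfolding maximal_def by blast
qed

text \<open>A basis extending the prescribed columns has exactly as many further members as there are free
  column positions, so a bijection distributes them.\<close>

lemma (in vec_space) invertible_completion:
  assumes J: "J \<subseteq> {..<n}" and inj: "inj_on f J"
    and f: "f ` J \<subseteq> carrier_vec n" and li: "lin_indpt (f ` J)"
  shows "\<exists>P. P \<in> carrier_mat n n \<and> det P \<noteq> 0 \<and> (\<forall>j\<in>J. col P j = f j)"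
proof -
  obtain W where W: "f ` J \<subseteq> W" "W \<subseteq> carrier_vec n" "lin_indpt W" "finite W" "card W = n"
    using basis_extension[OF f li] by blast
  have finJ: "finite J" using J finite_subset by blast
  have "card ({..<n} - J) = card (W - f ` J)"
    using J W inj finJ by (simp add: card_Diff_subset card_image)
  then obtain g where g: "bij_betw g ({..<n} - J) (W - f ` J)"
    using finite_same_card_bij[of "{..<n} - J" "W - f ` J"] W(4) by auto
  define h where "h j = (if j \<in> J then f j else g j)" for j
  have "bij_betw h (J \<union> ({..<n} - J)) (f ` J \<union> (W - f ` J))"
  proof (rule bij_betw_combine)
    show "bij_betw h J (f ` J)"
      using inj by (auto simp: bij_betw_def h_def inj_on_def)
    show "bij_betw h ({..<n} - J) (W - f ` J)"
      using g by (subst bij_betw_cong[of _ h g]) (auto simp: h_def)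
  qed auto
  moreover have "J \<union> ({..<n} - J) = {..<n}" "f ` J \<union> (W - f ` J) = W" using J W by auto
  ultimately have h: "bij_betw h {..<n} W" by simp
  define P where "P = mat_of_cols n (map h [0..<n])"
  have P: "P \<in> carrier_mat n n"
    using mat_of_cols_carrier(1)[of n "map h [0..<n]"] by (simp add: P_def)
  have hc: "h j \<in> carrier_vec n" if "j < n" for j
    using h that W(2) by (auto simp: bij_betw_def)
  have cols: "cols P = map h [0..<n]"
    unfolding P_def using hc by (intro cols_mat_of_cols) auto
  have "distinct (cols P)"
    using h unfolding cols by (auto simp: distinct_map bij_betw_def atLeast0LessThan)
  moreover have "set (cols P) = W"
    using h unfolding cols by (auto simp: bij_betw_def atLeast0LessThan)
  ultimately have "rank P = n" using lin_indpt_full_rank[OF P] W(3) by simp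
  then have "det P \<noteq> 0" using det_rank_iff[OF P] by simp
  moreover have "col P j = f j" if "j \<in> J" for j
  proof -
    have "j < n" using that J by auto
    then have "col P j = cols P ! j" using P by simp
    then show ?thesis using that \<open>j < n\<close> by (simp add: cols h_def)
  qed
  ultimately show ?thesis using P by blast
qed

lemma (in vec_space) lin_indpt_singleton:
  fixes v :: "'a vec"
  assumes "v \<in> carrier_vec n" "v \<noteq> 0\<^sub>v n"
  shows "lin_indpt {v}"
proof -
  have "lin_indpt {}" by (simp add: lin_dep_def)
  then have "v \<in> span {} \<longleftrightarrow> lin_dep ({} \<union> {v})"
    using lin_dep_iff_in_span[of "{}" v] assms by simp
  then show ?thesis using assms by (simp add: span_empty)
qed

lemma (in vec_space) invertible_with_column:
  fixes v :: "'a vec"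
  assumes "v \<in> carrier_vec n" "v \<noteq> 0\<^sub>v n"
  shows "\<exists>P. P \<in> carrier_mat n n \<and> det P \<noteq> 0 \<and> col P 0 = v"
proof -
  have "0 < n" using assms by (cases n) auto
  then show ?thesis
    using invertible_completion[of "{0}" "\<lambda>_. v"] lin_indpt_singleton[OF assms] assms by auto
qed

lemma (in vec_space) rank_column_vector:
  assumes A: "A \<in> carrier_mat n 1" and nz: "col A 0 \<noteq> 0\<^sub>v n"
  shows "rank A = 1"
proof -
  have "cols A = [col A 0]" using A unfolding cols_def by simp
  moreover have "lin_indpt {col A 0}" using A nz by (intro lin_indpt_singleton) auto
  ultimately show ?thesis using lin_indpt_full_rank[OF A] by simp
qed

text \<open>A matrix of rank \<open>r\<close> has \<open>r\<close> independent columns, and the other columns can be replaced so as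
  to make it invertible. This allows a substitution of low rank to be compared with an invertible
  one that agrees with it on \<open>r\<close> variables.\<close>

lemma (in vec_space) invertible_sharing_columns:
  assumes M: "M \<in> carrier_mat n n"
  shows "\<exists>P J. P \<in> carrier_mat n n \<and> det P \<noteq> 0 \<and> J \<subseteq> {..<n} \<and> card J = rank M \<and>
    (\<forall>j\<in>J. col P j = col M j)"
proof -
  have colsM: "set (cols M) \<subseteq> carrier_vec n" using M cols_dim by blast
  obtain U where U: "finite U" "maximal U (\<lambda>T. T \<subseteq> set (cols M) \<and> lin_indpt T)"
    using maximal_exists_superset[of "set (cols M)" "\<lambda>T. T \<subseteq> set (cols M) \<and> lin_indpt T" "{}"]
    by (auto simp: lin_dep_def)
  have sub: "U \<subseteq> col M ` {..<n}"
    using U(2) M unfolding maximal_def by (auto simp: cols_def atLeast0LessThan)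
  then obtain J where J: "J \<subseteq> {..<n}" "inj_on (col M) J" "col M ` J = U"
    by (metis subset_image_inj)
  have "card J = rank M"
    using rank_card_indpt[OF M U(2)] J card_image by metis
  moreover have "U \<subseteq> carrier_vec n" "lin_indpt U"
    using U(2) colsM unfolding maximal_def by auto
  ultimately show ?thesis
    using invertible_completion[of J "col M"] J by blast
qed

text \<open>This keeps the infima in \<^const>\<open>frak_d\<close> away from the empty set. The witness lists the first
  \<open>r\<close> unit vectors and repeats the last of them.\<close>

lemma (in vec_space) ex_matrix_of_rank:
  assumes "r \<le> n" "r \<le> nc"
  shows "\<exists>A. A \<in> carrier_mat n nc \<and> rank A = r"
proof (cases "r = 0")
  case True
  then show ?thesis using rank_0I[of nc] by (intro exI[of _ "0\<^sub>m n nc"]) auto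
next
  case False
  define e :: "nat \<Rightarrow> 'a vec" where "e = unit_vec n"
  define f where "f j = e (min j (r - 1))" for j
  define A where "A = mat_of_cols n (map f [0..<nc])"
  have A: "A \<in> carrier_mat n nc"
    using mat_of_cols_carrier(1)[of n "map f [0..<nc]"] by (simp add: A_def)
  have "cols A = map f [0..<nc]"
    unfolding A_def by (intro cols_mat_of_cols) (auto simp: f_def e_def)
  moreover have "(\<lambda>j. min j (r - 1)) ` {..<nc} = {..<r}"
  proof safe
    fix j assume "j < r"
    then show "j \<in> (\<lambda>j. min j (r - 1)) ` {..<nc}"
      using assms by (intro image_eqI[of _ _ j]) auto
  qed (use False in auto)
  then have "f ` {..<nc} = e ` {..<r}"
    unfolding f_def by (metis image_image)
  ultimately have cols: "set (cols A) = e ` {..<r}" by (simp add: atLeast0LessThan)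
  have "inj_on e {..<r}"
    unfolding e_def using assms by (auto intro!: inj_onI)
  then have card: "card (set (cols A)) = r" unfolding cols by (simp add: card_image)
  have "e ` {..<r} \<subseteq> set (unit_vecs n)"
    using assms by (auto simp: e_def unit_vecs_def)
  then have "lin_indpt (set (cols A))"
    unfolding cols using unit_vecs_basis subset_li_is_li unfolding basis_def by blast
  then have "maximal (set (cols A)) (\<lambda>T. T \<subseteq> set (cols A) \<and> lin_indpt T)"
    by (simp add: maximal_def subset_antisym)
  then have "rank A = r" using rank_card_indpt[OF A] card by blast
  then show ?thesis using A by blast
qed

section \<open>Zero blocks\<close>

text \<open>A nonzero determinant has a nonzero term in its Leibniz expansion, that is, a permutation
  avoiding the zero entries. It must map \<open>I\<close> injectively into the complement of \<open>J\<close>.\<close>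

lemma det_zero_block:
  fixes B :: "'a :: idom mat"
  assumes B: "B \<in> carrier_mat n n" and det: "det B \<noteq> 0"
    and I: "I \<subseteq> {..<n}" and J: "J \<subseteq> {..<n}"
    and zero: "\<And>i j. i \<in> I \<Longrightarrow> j \<in> J \<Longrightarrow> B $$ (i, j) = 0"
  shows "card I + card J \<le> n"
proof -
  obtain p where p: "p permutes {0..<n}" and "(\<Prod>i = 0..<n. B $$ (i, p i)) \<noteq> 0"
    using det unfolding det_def'[OF B] by (metis (no_types, lifting) mem_Collect_eq mult_zero_right sum.neutral)
  then have nz: "B $$ (i, p i) \<noteq> 0" if "i < n" for i using that by auto
  have "p ` I \<subseteq> {..<n} - J"
    using nz zero I permutes_in_image[OF p] by (force simp: atLeast0LessThan)
  then have "card (p ` I) \<le> card ({..<n} - J)" by (intro card_mono) auto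
  also have "\<dots> = n - card J" using J by (simp add: card_Diff_subset finite_subset)
  also have "card (p ` I) = card I"
    using permutes_inj[OF p] by (meson card_image inj_on_subset subset_UNIV)
  finally show ?thesis using card_mono[OF _ J] by simp
qed

section \<open>Derivatives of quadratic forms\<close>

text \<open>The factor \<open>1/2\<close> makes \<open>S\<close> the Hessian of \<open>Q\<close>, so that the gradient is \<open>S x\<close>.\<close>

lemma quadratic_form_symmetric_matrix:
  assumes "quadratic_form d Q"
  obtains S where "S \<in> carrier_mat d d" "transpose_mat S = S"
    "\<And>x. x \<in> carrier_vec d \<Longrightarrow> Q x = x \<bullet> (S *\<^sub>v x) / 2"
proof -
  obtain a :: "nat \<Rightarrow> nat \<Rightarrow> real" where a: "\<And>x. x \<in> carrier_vec d \<Longrightarrow>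
      Q x = (\<Sum>i<d. \<Sum>j<d. a i j * x $ i * x $ j)"
    using assms unfolding quadratic_form_def by blast
  define S where "S = Matrix.mat d d (\<lambda>(i, j). a i j + a j i)"
  have "Q x = x \<bullet> (S *\<^sub>v x) / 2" if x: "x \<in> carrier_vec d" for x
  proof -
    have "x \<bullet> (S *\<^sub>v x) = (\<Sum>i<d. \<Sum>j<d. (a i j + a j i) * x $ i * x $ j)"
      using x by (simp add: S_def scalar_prod_def atLeast0LessThan sum_distrib_left algebra_simps)
    also have "\<dots> = (\<Sum>i<d. \<Sum>j<d. a i j * x $ i * x $ j) + (\<Sum>i<d. \<Sum>j<d. a j i * x $ i * x $ j)"
      by (simp add: sum.distrib algebra_simps)
    also have "(\<Sum>i<d. \<Sum>j<d. a j i * x $ i * x $ j) = (\<Sum>i<d. \<Sum>j<d. a i j * x $ i * x $ j)"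
      by (subst sum.swap) (simp add: mult_ac)
    finally show ?thesis using a[OF x] by simp
  qed
  moreover have "S \<in> carrier_mat d d" "transpose_mat S = S" by (auto simp: S_def)
  ultimately show thesis using that by blast
qed

lemma quadratic_form_linear_combination:
  assumes "\<forall>Q \<in> set Qs. quadratic_form d Q"
  shows "quadratic_form d (\<lambda>x. \<Sum>k<length Qs. (Qs ! k) x * c k)"
proof -
  have "\<forall>k. \<exists>a :: nat \<Rightarrow> nat \<Rightarrow> real. k < length Qs \<longrightarrow> (\<forall>x \<in> carrier_vec d.
      (Qs ! k) x = (\<Sum>i<d. \<Sum>j<d. a i j * x $ i * x $ j))"
    using assms unfolding quadratic_form_def by auto
  from choice[OF this] obtain a :: "nat \<Rightarrow> nat \<Rightarrow> nat \<Rightarrow> real" where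
    "\<forall>k. k < length Qs \<longrightarrow> (\<forall>x \<in> carrier_vec d.
      (Qs ! k) x = (\<Sum>i<d. \<Sum>j<d. a k i j * x $ i * x $ j))" ..
  then have a: "(Qs ! k) x = (\<Sum>i<d. \<Sum>j<d. a k i j * x $ i * x $ j)"
    if "k < length Qs" "x \<in> carrier_vec d" for k x
    using that by blast
  have "(\<Sum>k<length Qs. (Qs ! k) x * c k) =
      (\<Sum>i<d. \<Sum>j<d. (\<Sum>k<length Qs. a k i j * c k) * x $ i * x $ j)"
    if "x \<in> carrier_vec d" for x
  proof -
    have "(\<Sum>k<length Qs. (Qs ! k) x * c k) =
        (\<Sum>k<length Qs. \<Sum>i<d. \<Sum>j<d. a k i j * c k * x $ i * x $ j)"
      using a that by (simp add: sum_distrib_left sum_distrib_right mult_ac)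
    also have "\<dots> = (\<Sum>i<d. \<Sum>k<length Qs. \<Sum>j<d. a k i j * c k * x $ i * x $ j)"
      by (rule sum.swap)
    also have "\<dots> = (\<Sum>i<d. \<Sum>j<d. \<Sum>k<length Qs. a k i j * c k * x $ i * x $ j)"
      by (rule sum.cong[OF refl]) (rule sum.swap)
    finally show ?thesis by (simp add: sum_distrib_right)
  qed
  then show ?thesis unfolding quadratic_form_def
    by (intro exI[of _ "\<lambda>i j. \<Sum>k<length Qs. a k i j * c k"]) blast
qed

lemma mult_mat_unit_vec:
  fixes M :: "'a :: comm_ring_1 mat"
  assumes "M \<in> carrier_mat m d" "i < d"
  shows "M *\<^sub>v unit_vec d i = col M i"
  using assms by (intro eq_vecI) auto

text \<open>The chain rule: with \<open>u = M x\<close> and \<open>w = M e\<^sub>i\<close>, the derivative of \<open>F (u + t w)\<close> at \<open>t = 0\<close> is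
  the pairing of \<open>w\<close> with the gradient \<open>S u\<close>.\<close>

lemma partial_deriv_pullback:
  assumes S: "S \<in> carrier_mat d d" "transpose_mat S = S"
    and F: "\<And>x. x \<in> carrier_vec d \<Longrightarrow> F x = x \<bullet> (S *\<^sub>v x) / 2"
    and M: "M \<in> carrier_mat d d" and i: "i < d" and x: "x \<in> carrier_vec d"
  shows "partial_deriv d i (\<lambda>x. F (M *\<^sub>v x)) x = col M i \<bullet> (S *\<^sub>v (M *\<^sub>v x))"
proof -
  define u where "u = M *\<^sub>v x"
  define w where "w = col M i"
  have u: "u \<in> carrier_vec d" and w: "w \<in> carrier_vec d" using M x by (auto simp: u_def w_def)
  have Su: "S *\<^sub>v u \<in> carrier_vec d" and Sw: "S *\<^sub>v w \<in> carrier_vec d" using S u w by auto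
  have sym: "u \<bullet> (S *\<^sub>v w) = w \<bullet> (S *\<^sub>v u)"
  proof -
    have "u \<bullet> (S *\<^sub>v w) = (S *\<^sub>v u) \<bullet> w"
      using transpose_vec_mult_scalar[of S d d w u] S u w by simp
    also have "\<dots> = w \<bullet> (S *\<^sub>v u)" by (rule comm_scalar_prod[OF Su w])
    finally show ?thesis .
  qed
  have expand: "F (M *\<^sub>v (x + t \<cdot>\<^sub>v unit_vec d i)) =
      u \<bullet> (S *\<^sub>v u) / 2 + t * (w \<bullet> (S *\<^sub>v u)) + t^2 * (w \<bullet> (S *\<^sub>v w)) / 2" for t
  proof -
    have "M *\<^sub>v (x + t \<cdot>\<^sub>v unit_vec d i) = u + t \<cdot>\<^sub>v w"
      using M x i by (simp add: u_def w_def mult_add_distrib_mat_vec[of _ d d]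
          mult_mat_vec[of _ d d] mult_mat_unit_vec)
    moreover have "F (u + t \<cdot>\<^sub>v w) = (u + t \<cdot>\<^sub>v w) \<bullet> (S *\<^sub>v (u + t \<cdot>\<^sub>v w)) / 2"
      using u w by (intro F) auto
    moreover have "S *\<^sub>v (u + t \<cdot>\<^sub>v w) = S *\<^sub>v u + t \<cdot>\<^sub>v (S *\<^sub>v w)"
      using S u w by (simp add: mult_add_distrib_mat_vec[of _ d d] mult_mat_vec[of _ d d])
    moreover have "(u + t \<cdot>\<^sub>v w) \<bullet> (S *\<^sub>v u + t \<cdot>\<^sub>v (S *\<^sub>v w)) =
        u \<bullet> (S *\<^sub>v u) + 2 * t * (w \<bullet> (S *\<^sub>v u)) + t^2 * (w \<bullet> (S *\<^sub>v w))"
      using u w Su Sw sym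
      by (simp add: add_scalar_prod_distrib[of _ d] scalar_prod_add_distrib[of _ d]
          power2_eq_square algebra_simps)
    ultimately show ?thesis by (simp add: field_simps)
  qed
  have "((\<lambda>t. u \<bullet> (S *\<^sub>v u) / 2 + t * (w \<bullet> (S *\<^sub>v u)) + t^2 * (w \<bullet> (S *\<^sub>v w)) / 2)
      has_field_derivative w \<bullet> (S *\<^sub>v u)) (at 0)"
    by (auto intro!: derivative_eq_intros)
  then show ?thesis
    unfolding partial_deriv_def expand u_def w_def by (rule DERIV_imp_deriv)
qed

section \<open>Counting variables\<close>

lemma NV_le: "NV d Fs \<le> d"
proof -
  have "NV d Fs \<le> card {..<d}" unfolding NV_def by (intro card_mono) auto
  then show ?thesis by simp
qed

lemma NV_mono: "set Fs \<subseteq> set Gs \<Longrightarrow> NV d Fs \<le> NV d Gs"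
  unfolding NV_def by (intro card_mono) auto

text \<open>If \<open>S v = 0\<close> with \<open>v \<noteq> 0\<close>, then \<open>F\<close> is constant in the direction \<open>v\<close>. An invertible substitution
  that sends the first unit vector to \<open>v\<close> therefore eliminates the first variable.\<close>

lemma hessian_nonsingular:
  assumes S: "S \<in> carrier_mat d d" "transpose_mat S = S"
    and F: "\<And>x. x \<in> carrier_vec d \<Longrightarrow> F x = x \<bullet> (S *\<^sub>v x) / 2"
    and full: "\<And>P. P \<in> carrier_mat d d \<Longrightarrow> Determinant.det P \<noteq> 0 \<Longrightarrow> NV d [\<lambda>x. F (P *\<^sub>v x)] = d"
  shows "Determinant.det S \<noteq> 0"
proof
  assume "Determinant.det S = 0"
  then obtain v where v: "v \<in> carrier_vec d" "v \<noteq> 0\<^sub>v d" "S *\<^sub>v v = 0\<^sub>v d"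
    using det_0_iff_vec_prod_zero_field[OF S(1)] by blast
  then have d: "0 < d" by (cases d) auto
  obtain P where P: "P \<in> carrier_mat d d" "Determinant.det P \<noteq> 0" "col P 0 = v"
    using vec_space.invertible_with_column[OF v(1,2)] by blast
  have "partial_deriv d 0 (\<lambda>x. F (P *\<^sub>v x)) x = 0" if x: "x \<in> carrier_vec d" for x
  proof -
    have Px: "P *\<^sub>v x \<in> carrier_vec d" using P x by auto
    have "partial_deriv d 0 (\<lambda>x. F (P *\<^sub>v x)) x = v \<bullet> (S *\<^sub>v (P *\<^sub>v x))"
      using partial_deriv_pullback[OF S F P(1) d x] P(3) by simp
    also have "\<dots> = (S *\<^sub>v v) \<bullet> (P *\<^sub>v x)"
      using transpose_vec_mult_scalar[OF S(1) Px v(1)] S(2) by simp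
    finally show ?thesis using v(3) Px by simp
  qed
  then have "{i. i < d \<and> (\<exists>G \<in> set [\<lambda>x. F (P *\<^sub>v x)]. \<exists>x \<in> carrier_vec d. partial_deriv d i G x \<noteq> 0)}
      \<subseteq> {1..<d}" by (auto simp: Suc_le_eq intro!: gr0I)
  then have "NV d [\<lambda>x. F (P *\<^sub>v x)] \<le> card {1..<d}"
    unfolding NV_def by (intro card_mono) auto
  then show False using full[OF P(1,2)] d by simp
qed

text \<open>Let \<open>I\<close> be the set of variables on which \<open>F \<circ> M\<close> depends, and let \<open>P\<close> be invertible with the same
  columns as \<open>M\<close> at a set \<open>J\<close> of \<open>rank M\<close> positions. The Hessian \<open>P\<^sup>T S P\<close> of \<open>F \<circ> P\<close> is nonsingular and
  agrees with the Hessian of \<open>F \<circ> M\<close> on \<open>J \<times> J\<close>, so it vanishes on \<open>(J - I) \<times> J\<close>. A nonsingular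
  matrix of size \<open>d\<close> has no zero block with \<open>|J - I| + |J| > d\<close>, and \<open>|J - I| \<ge> |J| - |I|\<close>.\<close>

lemma NV_pullback_ge:
  assumes S: "S \<in> carrier_mat d d" "transpose_mat S = S"
    and F: "\<And>x. x \<in> carrier_vec d \<Longrightarrow> F x = x \<bullet> (S *\<^sub>v x) / 2"
    and det: "Determinant.det S \<noteq> 0"
    and M: "M \<in> carrier_mat d d"
  shows "2 * vec_space.rank d M \<le> NV d [\<lambda>x. F (M *\<^sub>v x)] + d"
proof -
  obtain P J where P: "P \<in> carrier_mat d d" "Determinant.det P \<noteq> 0"
    and J: "J \<subseteq> {..<d}" "card J = vec_space.rank d M"
    and PM: "\<And>j. j \<in> J \<Longrightarrow> col P j = col M j"
    using vec_space.invertible_sharing_columns[OF M] by blast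
  define I where "I = {i. i < d \<and> (\<exists>x \<in> carrier_vec d. partial_deriv d i (\<lambda>x. F (M *\<^sub>v x)) x \<noteq> 0)}"
  define B where "B = transpose_mat P * (S * P)"
  have B: "B \<in> carrier_mat d d" using P S by (auto simp: B_def)
  have SP: "S * P \<in> carrier_mat d d" using S P by simp
  have "Determinant.det B = Determinant.det P * (Determinant.det S * Determinant.det P)"
    unfolding B_def using P S SP
    by (simp add: det_mult[of _ d] det_transpose[of _ d])
  then have "Determinant.det B \<noteq> 0" using P det by simp
  moreover have "B $$ (i, j) = 0" if i: "i \<in> J - I" and j: "j \<in> J" for i j
  proof -
    have ij: "i < d" "j < d" using i j J by auto
    have "B $$ (i, j) = col P i \<bullet> (S *\<^sub>v col P j)"
      using ij P S SP by (simp add: B_def col_mult2[of S d d P d] del: col_mult)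
    also have "\<dots> = col M i \<bullet> (S *\<^sub>v (M *\<^sub>v unit_vec d j))"
      using PM i j ij M by (simp add: mult_mat_unit_vec)
    also have "\<dots> = partial_deriv d i (\<lambda>x. F (M *\<^sub>v x)) (unit_vec d j)"
      using partial_deriv_pullback[OF S F M ij(1), of "unit_vec d j"] by simp
    also have "\<dots> = 0" using i ij unfolding I_def by auto
    finally show ?thesis .
  qed
  ultimately have "card (J - I) + card J \<le> d"
    using det_zero_block[OF B, of "J - I" J] J by auto
  moreover have "card J - card I \<le> card (J - I)"
    by (rule diff_card_le_card_Diff) (simp add: I_def)
  moreover have "NV d [\<lambda>x. F (M *\<^sub>v x)] = card I" by (simp add: NV_def I_def)
  ultimately show ?thesis using J by simp
qed

section \<open>Bounds on the infimum\<close>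

lemma frak_d_le:
  assumes "M \<in> carrier_mat d d" "vec_space.rank d M = d'"
    and "N \<in> carrier_mat (length Qs) n'" "vec_space.rank (length Qs) N = n'"
  shows "frak_d d Qs d' n' \<le> NV d (R_transform N M Qs)"
proof -
  have "frak_d d Qs d' n' \<le>
      (INF N \<in> {N \<in> carrier_mat (length Qs) n'. vec_space.rank (length Qs) N = n'}.
        NV d (R_transform N M Qs))"
    unfolding frak_d_def by (rule cINF_lower) (use assms in auto)
  also have "\<dots> \<le> NV d (R_transform N M Qs)"
    by (rule cINF_lower) (use assms in auto)
  finally show ?thesis .
qed

lemma frak_d_ge:
  assumes "d' \<le> d" "n' \<le> length Qs"
    and "\<And>M N. M \<in> carrier_mat d d \<Longrightarrow> vec_space.rank d M = d' \<Longrightarrow>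
      N \<in> carrier_mat (length Qs) n' \<Longrightarrow> vec_space.rank (length Qs) N = n' \<Longrightarrow>
      b \<le> NV d (R_transform N M Qs)"
  shows "b \<le> frak_d d Qs d' n'"
  unfolding frak_d_def
  using vec_space.ex_matrix_of_rank[OF assms(1) assms(1)] vec_space.ex_matrix_of_rank[OF assms(2) order_refl]
    assms
  by (intro cINF_greatest) auto

text \<open>The coefficients of a nontrivial combination of the forms make up a column of rank 1, and an
  invertible substitution has rank \<open>d\<close>, so every such pair competes in the infimum.\<close>

lemma NV_combination_eq:
  assumes full: "frak_d d Qs d 1 = d"
    and N: "N \<in> carrier_mat (length Qs) 1" "col N 0 \<noteq> 0\<^sub>v (length Qs)"
    and P: "P \<in> carrier_mat d d" "Determinant.det P \<noteq> 0"
  shows "NV d [\<lambda>x. \<Sum>j<length Qs. (Qs ! j) (P *\<^sub>v x) * N $$ (j, 0)] = d"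
proof -
  have "d \<le> NV d (R_transform N P Qs)"
    using frak_d_le[OF P(1) _ N(1)] vec_space.rank_column_vector[OF N]
      vec_space.low_rank_det_zero[OF P] full by simp
  also have "R_transform N P Qs = [\<lambda>x. \<Sum>j<length Qs. (Qs ! j) (P *\<^sub>v x) * N $$ (j, 0)]"
    using N by (simp add: R_transform_def)
  finally show ?thesis using NV_le[of d] le_antisym by blast
qed

theorem corollary1p15:
  fixes d n :: nat and Qs :: "(real Matrix.vec \<Rightarrow> real) list"
  assumes "d \<ge> 1" and "n \<ge> 1"
    and "length Qs = n"
    and "\<forall>Q \<in> set Qs. quadratic_form d Q"
    and "frak_d d Qs d 1 = d"
  shows "\<forall>d' n' :: nat. real d / 2 \<le> real d' \<longrightarrow> d' \<le> d \<longrightarrow> n' \<le> n \<longrightarrow>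
    real (frak_d d Qs d' n') \<ge> real n' / real n * real d - 2 * (real d - real d')"
proof (intro allI impI)
  fix d' n' :: nat
  assume d': "d' \<le> d" and n': "n' \<le> n"
  show "real (frak_d d Qs d' n') \<ge> real n' / real n * real d - 2 * (real d - real d')"
  proof (cases "n' = 0")
    case True
    then show ?thesis using d' by simp
  next
    case False
    have "2 * d' - d \<le> frak_d d Qs d' n'"
    proof (rule frak_d_ge[OF d'])
      show "n' \<le> length Qs" using n' assms(3) by simp
      fix M N :: "real Matrix.mat"
      assume M: "M \<in> carrier_mat d d" "vec_space.rank d M = d'"
        and N: "N \<in> carrier_mat (length Qs) n'" "vec_space.rank (length Qs) N = n'"
      have "N \<noteq> 0\<^sub>m (length Qs) n'"
        using vec_space.rank_0I[of "length Qs" n', where ?'a = real] N False by auto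
      then obtain k where k: "k < n'" "col N k \<noteq> 0\<^sub>v (length Qs)"
        using N(1) by (metis col_zero index_zero_mat(2,3) mat_col_eqI carrier_matD)
      define F where "F x = (\<Sum>j<length Qs. (Qs ! j) x * N $$ (j, k))" for x
      \<comment> \<open>the hypothesis on invertible substitutions concerns matrices with a single column\<close>
      define N1 where "N1 = Matrix.mat (length Qs) 1 (\<lambda>(i, j). N $$ (i, k))"
      have "N1 \<in> carrier_mat (length Qs) 1" by (simp add: N1_def)
      moreover have "col N1 0 = col N k" using N k by (intro eq_vecI) (auto simp: N1_def)
      ultimately have "NV d [\<lambda>x. F (P *\<^sub>v x)] = d"
        if "P \<in> carrier_mat d d" "Determinant.det P \<noteq> 0" for P
        using NV_combination_eq[OF assms(5) _ _ that, of N1] k by (simp add: F_def N1_def)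
      moreover have "quadratic_form d F"
        unfolding F_def by (rule quadratic_form_linear_combination[OF assms(4)])
      then obtain S where S: "S \<in> carrier_mat d d" "transpose_mat S = S"
        "\<And>x. x \<in> carrier_vec d \<Longrightarrow> F x = x \<bullet> (S *\<^sub>v x) / 2"
        by (rule quadratic_form_symmetric_matrix) blast
      ultimately have "2 * d' \<le> NV d [\<lambda>x. F (M *\<^sub>v x)] + d"
        using NV_pullback_ge[OF S hessian_nonsingular[OF S] M(1)] M(2) by blast
      moreover have "NV d [\<lambda>x. F (M *\<^sub>v x)] \<le> NV d (R_transform N M Qs)"
        using N k by (intro NV_mono) (auto simp: R_transform_def F_def)
      ultimately show "2 * d' - d \<le> NV d (R_transform N M Qs)" by simp
    qed
    then have "2 * real d' - real d \<le> real (frak_d d Qs d' n')" by linarith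
    moreover have "real n' / real n * real d \<le> 1 * real d"
      using n' assms(2) by (intro mult_right_mono) auto
    ultimately show ?thesis by simp
  qed
qed

end
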